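(* Let $X$ be a countable, second countable topological space, let $H$ be the union of all minimal non-empty open subsets of $X$ (minimal with respect to inclusion among the non-empty open subsets of $X$), and let $L$ be the interior of $X\setminus H$. If there are infinitely many pairwise disjoint open subsets of $X$ contained in $X\setminus H$ (equivalently, contained in $L$), then $\mathcal{M}(X)$ is $\boldsymbol{\Pi}^0_3$-complete; otherwise $\mathcal{M}(X)\in\boldsymbol{\Sigma}^0_2(\mathcal{P}(X))$.
   Context: "Countable" means countably infinite (the paper writes "at most countable" when finite sets are allowed). For a topological space $X$, a subset $A\subseteq X$ is dense in an open set $U$ if $U\subseteq\overline{A}$, and codense in $U$ if $U\subseteq\overline{X\setminus A}$. A subset $A\subseteq X$ is monitorable if for every non-empty open set $U\subseteq X$ either $A$ is not dense in $U$ or $A$ is not codense in $U$. $\mathcal{M}(X)\subseteq\mathcal{P}(X)$ denotes the family of monitorable subsets of $X$. The powerset $\mathcal{P}(X)$ is identified with $2^X$ via characteristic functions and carries the product topology (with $2=\{0,1\}$ discrete); for countable $X$ it is homeomorphic to the Cantor space. $\boldsymbol{\Sigma}^0_\alpha,\boldsymbol{\Pi}^0_\alpha$ are the usual classes of the Borel hierarchy ($\boldsymbol{\Sigma}^0_1$ = open sets, $\boldsymbol{\Pi}^0_\alpha$ = complements of $\boldsymbol{\Sigma}^0_\alpha$ sets, $\boldsymbol{\Sigma}^0_\alpha$ = at most countable unions of sets in $\bigcup_{\beta<\alpha}\boldsymbol{\Pi}^0_\beta$ for $\alpha\geq 2$). For a boldface pointclass $\boldsymbol{\Gamma}$ and a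 Polish space $Z$, a set $A\subseteq Z$ is $\boldsymbol{\Gamma}$-hard if for every zero-dimensional Polish space $Y$ and every $B\in\boldsymbol{\Gamma}(Y)$ there is a continuous $f:Y\to Z$ with $B=f^{-1}(A)$; $A$ is $\boldsymbol{\Gamma}$-complete if $A\in\boldsymbol{\Gamma}(Z)$ and $A$ is $\boldsymbol{\Gamma}$-hard. *)

theory Defs
  imports "HOL-Analysis.Analysis"
begin

definition monitorable :: "'a topology \<Rightarrow> 'a set \<Rightarrow> bool" where
  "monitorable X A \<longleftrightarrow>
     A \<subseteq> topspace X \<and>
     (\<forall>U. openin X U \<and> U \<noteq> {} \<longrightarrow>
        \<not> U \<subseteq> X closure_of A \<or> \<not> U \<subseteq> X closure_of (topspace X - A))"

definition monitorable_sets :: "'a topology \<Rightarrow> 'a set set" where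
  "monitorable_sets X = {A. monitorable X A}"

text \<open>The topology that the subsets of \<^term>\<open>S\<close> inherit from the product space
  \<open>2\<^sup>S\<close> (with \<open>2\<close> discrete) by identifying a set with its characteristic function.\<close>

definition powerset_topology :: "'a set \<Rightarrow> 'a set topology" where
  "powerset_topology S =
     pullback_topology (Pow S) (\<lambda>A. \<lambda>x\<in>S. x \<in> A)
       (product_topology (\<lambda>_. discrete_topology (UNIV :: bool set)) S)"

text \<open>The finite levels of the Borel hierarchy. Level \<open>0\<close>, which does not occur in the
  usual indexing, is empty by convention and so contributes nothing to the higher levels.\<close>

fun Sigma0 :: "nat \<Rightarrow> 'a topology \<Rightarrow> 'a set set" where
  "Sigma0 0 X = {}"
| "Sigma0 (Suc 0) X = {U. openin X U}"
| "Sigma0 (Suc (Suc n)) X =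
     {\<Union>F | F. countable F \<and> F \<subseteq> (\<Union>m\<in>{..Suc n}. (\<lambda>B. topspace X - B) ` Sigma0 m X)}"

definition Pi0 :: "nat \<Rightarrow> 'a topology \<Rightarrow> 'a set set" where
  "Pi0 n X = (\<lambda>B. topspace X - B) ` Sigma0 n X"

definition Polish_space :: "'a topology \<Rightarrow> bool" where
  "Polish_space Y \<longleftrightarrow> completely_metrizable_space Y \<and> separable_space Y"

text \<open>HOL cannot quantify over types inside a formula, so the type \<open>'y\<close> carrying the
  zero-dimensional Polish test spaces is a parameter. Stated for a free type variable \<open>'y\<close>,
  hardness ranges over all zero-dimensional Polish spaces. For topologies \<open>Y dim_le 0\<close>
  means that the clopen sets form a base.\<close>

definition Pi0_hard :: "'y itself \<Rightarrow> nat \<Rightarrow> 'z topology \<Rightarrow> 'z set \<Rightarrow> bool" where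
  "Pi0_hard TYPE('y) n Z A \<longleftrightarrow>
     (\<forall>(Y :: 'y topology) B. Polish_space Y \<and> Y dim_le 0 \<and> B \<in> Pi0 n Y \<longrightarrow>
        (\<exists>f. continuous_map Y Z f \<and> B = {y \<in> topspace Y. f y \<in> A}))"

definition Pi0_complete :: "'y itself \<Rightarrow> nat \<Rightarrow> 'z topology \<Rightarrow> 'z set \<Rightarrow> bool" where
  "Pi0_complete TYPE('y) n Z A \<longleftrightarrow> A \<in> Pi0 n Z \<and> Pi0_hard TYPE('y) n Z A"

definition minimal_open :: "'a topology \<Rightarrow> 'a set \<Rightarrow> bool" where
  "minimal_open X U \<longleftrightarrow>
     openin X U \<and> U \<noteq> {} \<and> (\<forall>V. openin X V \<and> V \<noteq> {} \<and> V \<subseteq> U \<longrightarrow> V = U)"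

text \<open>A member of an infinite pairwise disjoint family may be empty, but at most one is,
  so requiring non-emptiness would not change the following notion.\<close>

definition infinitely_many_disjoint_opens_in :: "'a topology \<Rightarrow> 'a set \<Rightarrow> bool" where
  "infinitely_many_disjoint_opens_in X S \<longleftrightarrow>
     (\<exists>\<U>. infinite \<U> \<and> pairwise disjnt \<U> \<and> (\<forall>U\<in>\<U>. openin X U \<and> U \<subseteq> S))"

end

theory Submission
  imports Defs
begin

text \<open>
  A set is monitorable iff every non-empty open set contains a non-empty open set \<open>V\<close> that it
  decides, i.e. contains or misses; for fixed \<open>V\<close> this is a closed condition on the set, and
  second countability turns the quantifiers into countable ones. If there are only finitely many
  disjoint open sets off the minimal ones, a finite family of irreducible open sets is dense
  there, and it suffices that one \<open>V\<close> in each member of this family, as well as each minimal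
  open set, be decided: an \<open>F\<^sub>\<sigma>\<close> condition.

  Otherwise take disjoint open sets \<open>U\<^sub>n\<close> off the minimal ones. The points with nowhere dense
  singleton are infinite in number in every open set there (a single point may be dense, as no
  separation axiom is assumed, so not every point will do). Hence there are disjoint finite
  nowhere dense blocks \<open>D\<^sub>k\<close> such that every non-empty open set there meets almost all of them.
  A \<open>\<Pi>\<^sup>0\<^sub>3\<close> set in a zero-dimensional space has the form
  \<open>{y. \<forall>n. finite {k. y \<in> K n k}}\<close> with clopen \<open>K n k\<close>, and it is reduced to monitorability
  by letting \<open>f y\<close> contain \<open>D\<^sub>2\<^sub>k \<inter> U\<^sub>n\<close> iff \<open>y \<in> K n k\<close>.
\<close>

section \<open>Nowhere dense sets, monitorability through decided open sets, and pi-bases\<close>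

text \<open>For a subset of the space this says that its closure has empty interior; in this form
  open sets can be shrunk directly to avoid \<open>S\<close>.\<close>

definition nowhere_dense_in :: "'a topology \<Rightarrow> 'a set \<Rightarrow> bool" where
  "nowhere_dense_in X S \<longleftrightarrow>
     (\<forall>V. openin X V \<and> V \<noteq> {} \<longrightarrow> (\<exists>W. openin X W \<and> W \<noteq> {} \<and> W \<subseteq> V \<and> W \<inter> S = {}))"

lemma nowhere_dense_inE:
  assumes "nowhere_dense_in X S" "openin X V" "V \<noteq> {}"
  obtains W where "openin X W" "W \<noteq> {}" "W \<subseteq> V" "W \<inter> S = {}"
  using assms unfolding nowhere_dense_in_def by metis

text \<open>Shrink a given open set once for every point of \<open>S\<close>; finitely many
  shrinkings leave a non-empty open set.\<close>

lemma nowhere_dense_in_finite: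
  assumes "finite S" "\<And>x. x \<in> S \<Longrightarrow> nowhere_dense_in X {x}"
  shows "nowhere_dense_in X S"
  using assms
proof (induction S)
  case empty
  then show ?case
    unfolding nowhere_dense_in_def by auto
next
  case (insert x S)
  show ?case
    unfolding nowhere_dense_in_def
  proof (intro allI impI)
    fix V assume V: "openin X V \<and> V \<noteq> {}"
    have "nowhere_dense_in X S"
      using insert by simp
    then obtain W where W: "openin X W" "W \<noteq> {}" "W \<subseteq> V" "W \<inter> S = {}"
      using V by (elim nowhere_dense_inE) auto
    have "nowhere_dense_in X {x}"
      using insert by simp
    then obtain W' where "openin X W'" "W' \<noteq> {}" "W' \<subseteq> W" "W' \<inter> {x} = {}"
      using W(1,2) by (rule nowhere_dense_inE)
    with W show "\<exists>W. openin X W \<and> W \<noteq> {} \<and> W \<subseteq> V \<and> W \<inter> insert x S = {}"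
      by (intro exI[of _ W']) auto
  qed
qed

text \<open>Since \<open>U\<close> is open, a neighbourhood of a point of \<open>U\<close> may be
  cut down to its intersection with \<open>U\<close>.\<close>

lemma open_subset_closure_of_iff:
  assumes "openin X U"
  shows "U \<subseteq> X closure_of S \<longleftrightarrow>
           (\<forall>V. openin X V \<and> V \<noteq> {} \<and> V \<subseteq> U \<longrightarrow> V \<inter> S \<noteq> {})"
proof
  assume "U \<subseteq> X closure_of S"
  then show "\<forall>V. openin X V \<and> V \<noteq> {} \<and> V \<subseteq> U \<longrightarrow> V \<inter> S \<noteq> {}"
    unfolding subset_iff in_closure_of by blast
next
  assume *: "\<forall>V. openin X V \<and> V \<noteq> {} \<and> V \<subseteq> U \<longrightarrow> V \<inter> S \<noteq> {}"
  show "U \<subseteq> X closure_of S"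
  proof
    fix x assume "x \<in> U"
    have "T \<inter> S \<noteq> {}" if "openin X T" "x \<in> T" for T
      using *[rule_format, of "T \<inter> U"] that assms \<open>x \<in> U\<close> by blast
    moreover have "x \<in> topspace X"
      using \<open>x \<in> U\<close> openin_subset[OF assms] by blast
    ultimately show "x \<in> X closure_of S"
      unfolding in_closure_of by (auto simp: disjoint_iff)
  qed
qed

text \<open>If \<open>A\<close> is not dense in \<open>U\<close>, some non-empty open part of
  \<open>U\<close> misses \<open>A\<close>; if \<open>A\<close> is not codense in \<open>U\<close>,
  some such part lies inside \<open>A\<close>. Unlike closures, this condition on \<open>V\<close>
  is directly seen to be closed in \<open>A\<close>.\<close>

lemma monitorable_iff:
  "monitorable X A \<longleftrightarrow> A \<subseteq> topspace X \<and>
     (\<forall>U. openin X U \<and> U \<noteq> {} \<longrightarrow>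
        (\<exists>V. openin X V \<and> V \<noteq> {} \<and> V \<subseteq> U \<and> (V \<subseteq> A \<or> V \<inter> A = {})))"
proof -
  have key: "(\<not> U \<subseteq> X closure_of A \<or> \<not> U \<subseteq> X closure_of (topspace X - A)) \<longleftrightarrow>
      (\<exists>V. openin X V \<and> V \<noteq> {} \<and> V \<subseteq> U \<and> (V \<subseteq> A \<or> V \<inter> A = {}))" if "openin X U" for U
  proof -
    have "V \<inter> (topspace X - A) = {} \<longleftrightarrow> V \<subseteq> A" if "openin X V" for V
      using openin_subset[OF that] by blast
    then show ?thesis
      unfolding open_subset_closure_of_iff[OF that] by blast
  qed
  show ?thesis
    unfolding monitorable_def by (simp only: key cong: imp_cong)
qed

text \<open>A countable base without the empty set is a countable pi-base: a member below each
  non-empty open set, with no prescribed point, is what the quantifiers over open sets call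
  for.\<close>

lemma second_countable_pi_base:
  assumes "second_countable X"
  obtains \<B> where "countable \<B>" "\<And>V. V \<in> \<B> \<Longrightarrow> openin X V" "\<And>V. V \<in> \<B> \<Longrightarrow> V \<noteq> {}"
    "\<And>U. openin X U \<Longrightarrow> U \<noteq> {} \<Longrightarrow> \<exists>V\<in>\<B>. V \<subseteq> U"
proof -
  obtain \<B> where \<B>: "countable \<B>" "\<forall>V\<in>\<B>. openin X V"
    "\<forall>U x. openin X U \<and> x \<in> U \<longrightarrow> (\<exists>V\<in>\<B>. x \<in> V \<and> V \<subseteq> U)"
    using assms unfolding second_countable_def by blast
  show ?thesis
  proof
    show "countable (\<B> - {{}})"
      using \<B> by blast
    show "\<exists>V\<in>\<B> - {{}}. V \<subseteq> U" if "openin X U" "U \<noteq> {}" for U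
      using \<B>(3) that by (metis DiffI all_not_in_conv singletonD)
  qed (use \<B> in auto)
qed

subsection \<open>The Cantor topology on a powerset\<close>

lemma topspace_powerset_topology [simp]: "topspace (powerset_topology S) = Pow S"
  by (auto simp: powerset_topology_def topspace_pullback_topology)

lemma continuous_map_powerset_member:
  assumes "x \<in> S"
  shows "continuous_map (powerset_topology S) (discrete_topology UNIV) (\<lambda>A. x \<in> A)"
proof -
  have "continuous_map (powerset_topology S) (discrete_topology UNIV)
          ((\<lambda>h. h x) \<circ> (\<lambda>A. \<lambda>x\<in>S. x \<in> A))"
    unfolding powerset_topology_def
    using continuous_map_product_projection[OF assms, of "\<lambda>_. discrete_topology (UNIV :: bool set)"]
    by (rule continuous_map_pullback)
  then show ?thesis
    using assms by (simp add: comp_def)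
qed

text \<open>\<open>V\<close> may be infinite: the complement is a union of subbasic open sets, one
  for each point of \<open>V\<close>.\<close>

lemma closedin_powerset_superset:
  assumes "V \<subseteq> S"
  shows "closedin (powerset_topology S) {A \<in> Pow S. V \<subseteq> A}"
proof -
  have "openin (powerset_topology S) {A \<in> Pow S. x \<notin> A}" if "x \<in> V" for x
    using openin_continuous_map_preimage[OF continuous_map_powerset_member, of x S "{False}"]
      that assms by auto
  then have "openin (powerset_topology S) (\<Union>x\<in>V. {A \<in> Pow S. x \<notin> A})"
    by blast
  moreover have "Pow S - {A \<in> Pow S. V \<subseteq> A} = (\<Union>x\<in>V. {A \<in> Pow S. x \<notin> A})"
    by auto
  ultimately show ?thesis
    by (auto simp: closedin_def)
qed

lemma closedin_powerset_disjoint: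
  assumes "V \<subseteq> S"
  shows "closedin (powerset_topology S) {A \<in> Pow S. V \<inter> A = {}}"
proof -
  have "openin (powerset_topology S) {A \<in> Pow S. x \<in> A}" if "x \<in> V" for x
    using openin_continuous_map_preimage[OF continuous_map_powerset_member, of x S "{True}"]
      that assms by auto
  then have "openin (powerset_topology S) (\<Union>x\<in>V. {A \<in> Pow S. x \<in> A})"
    by blast
  moreover have "Pow S - {A \<in> Pow S. V \<inter> A = {}} = (\<Union>x\<in>V. {A \<in> Pow S. x \<in> A})"
    by auto
  ultimately show ?thesis
    by (auto simp: closedin_def)
qed

lemma closedin_powerset_decided:
  assumes "V \<subseteq> S"
  shows "closedin (powerset_topology S) {A \<in> Pow S. V \<subseteq> A \<or> V \<inter> A = {}}"
proof -
  have "{A \<in> Pow S. V \<subseteq> A \<or> V \<inter> A = {}} =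
      {A \<in> Pow S. V \<subseteq> A} \<union> {A \<in> Pow S. V \<inter> A = {}}"
    by blast
  then show ?thesis
    using closedin_Un[OF closedin_powerset_superset closedin_powerset_disjoint] assms by simp
qed

lemma fsigma_in_powerset_decided:
  assumes "countable \<V>" "\<And>V. V \<in> \<V> \<Longrightarrow> V \<subseteq> S"
  shows "fsigma_in (powerset_topology S) (\<Union>V\<in>\<V>. {A \<in> Pow S. V \<subseteq> A \<or> V \<inter> A = {}})"
proof (rule fsigma_in_Union)
  show "countable ((\<lambda>V. {A \<in> Pow S. V \<subseteq> A \<or> V \<inter> A = {}}) ` \<V>)"
    using assms(1) by (rule countable_image)
  show "fsigma_in (powerset_topology S) B"
    if "B \<in> (\<lambda>V. {A \<in> Pow S. V \<subseteq> A \<or> V \<inter> A = {}}) ` \<V>" for B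
    using that closed_imp_fsigma_in[OF closedin_powerset_decided[OF assms(2)]] by (elim imageE) simp
qed

text \<open>Continuity into a product is tested coordinatewise, and a map into the discrete
  two-point space is continuous as soon as the preimage of one value is clopen.\<close>

lemma continuous_map_into_powerset:
  assumes "\<And>y. y \<in> topspace Y \<Longrightarrow> f y \<subseteq> S"
    and "\<And>x. x \<in> S \<Longrightarrow> openin Y {y \<in> topspace Y. x \<in> f y}"
    and "\<And>x. x \<in> S \<Longrightarrow> closedin Y {y \<in> topspace Y. x \<in> f y}"
  shows "continuous_map Y (powerset_topology S) f"
  unfolding powerset_topology_def
proof (rule continuous_map_pullback')
  have "continuous_map Y (discrete_topology UNIV) (\<lambda>y. x \<in> f y)" if "x \<in> S" for x
    unfolding continuous_map_def
  proof (intro conjI allI impI)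
    fix U :: "bool set"
    have eq: "{y \<in> topspace Y. (x \<in> f y) \<in> U} =
        (if True \<in> U then {y \<in> topspace Y. x \<in> f y} else {}) \<union>
        (if False \<in> U then topspace Y - {y \<in> topspace Y. x \<in> f y} else {})"
      by auto (metis (full_types))+
    show "openin Y {y \<in> topspace Y. (x \<in> f y) \<in> U}"
      unfolding eq using assms(2,3)[OF that] by (intro openin_Un) (auto simp: closedin_def)
  qed auto
  then show "continuous_map Y (product_topology (\<lambda>_. discrete_topology UNIV) S)
      ((\<lambda>A. \<lambda>x\<in>S. x \<in> A) \<circ> f)"
    unfolding continuous_map_componentwise by auto
  show "topspace Y \<subseteq> f -` Pow S"
    using assms(1) by auto
qed

subsection \<open>Low levels of the Borel hierarchy\<close>

text \<open>Level \<open>0\<close> is empty, so the complements entering level \<open>2\<close> are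
  exactly the closed sets. This gives access to the calculus of F-sigma and G-delta sets.\<close>

lemma Sigma0_2_iff_fsigma_in: "B \<in> Sigma0 2 X \<longleftrightarrow> fsigma_in X B"
proof -
  have eq: "(\<lambda>B. topspace X - B) ` Collect (openin X) = Collect (closedin X)"
    by (auto simp: closedin_def image_iff) (metis Diff_Diff_Int Int_absorb1)
  have "(\<Union>m\<in>{..Suc 0}. (\<lambda>B. topspace X - B) ` Sigma0 m X) = Collect (closedin X)"
    unfolding eq[symmetric] by (simp add: atMost_Suc)
  then show ?thesis
    unfolding numeral_2_eq_2 fsigma_in_def union_of_def by auto
qed

lemma Pi0_2_iff_gdelta_in: "B \<in> Pi0 2 X \<longleftrightarrow> gdelta_in X B"
proof
  assume "B \<in> Pi0 2 X"
  then obtain C where "fsigma_in X C" "B = topspace X - C"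
    unfolding Pi0_def by (auto simp: Sigma0_2_iff_fsigma_in)
  then show "gdelta_in X B"
    by (simp add: gdelta_in_diff)
next
  assume B: "gdelta_in X B"
  then have "topspace X - B \<in> Sigma0 2 X"
    by (simp add: Sigma0_2_iff_fsigma_in gdelta_in_fsigma_in)
  moreover have "B = topspace X - (topspace X - B)"
    using gdelta_in_subset[OF B] by blast
  ultimately show "B \<in> Pi0 2 X"
    unfolding Pi0_def by (rule rev_image_eqI)
qed

lemma Union_gdelta_in_Sigma0_3:
  assumes "countable F" "\<And>B. B \<in> F \<Longrightarrow> gdelta_in X B"
  shows "\<Union>F \<in> Sigma0 3 X"
proof -
  have "F \<subseteq> Pi0 2 X"
    using assms(2) by (auto simp: Pi0_2_iff_gdelta_in)
  also have "Pi0 2 X \<subseteq> (\<Union>m\<in>{..Suc 1}. (\<lambda>B. topspace X - B) ` Sigma0 m X)"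
    unfolding Pi0_def by (rule UN_upper[of 2]) simp
  finally show ?thesis
    using assms(1) unfolding numeral_3_eq_3 by auto
qed

text \<open>Metrizability makes closed sets G-delta, so the complements of level \<open>1\<close>
  sets in the union are absorbed by those of level \<open>2\<close>.\<close>

lemma Sigma0_3_gdelta_in_sequence:
  assumes "metrizable_space X" "B \<in> Sigma0 3 X"
  obtains G :: "nat \<Rightarrow> 'a set" where "\<And>n. gdelta_in X (G n)" "B = (\<Union>n. G n)"
proof -
  obtain F where F: "countable F" "B = \<Union>F"
    "F \<subseteq> (\<Union>m\<in>{..Suc 1}. (\<lambda>B. topspace X - B) ` Sigma0 m X)"
    using assms(2) unfolding numeral_3_eq_3 by auto
  have "{..Suc 1} = {0, Suc 0, 2}"
    by auto
  then have sub: "F \<subseteq> (\<lambda>B. topspace X - B) ` Sigma0 (Suc 0) X \<union> Pi0 2 X"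
    using F(3) unfolding Pi0_def by auto
  \<comment> \<open>The empty set is adjoined so that even an empty \<open>F\<close> can be
    enumerated by the naturals; the union stays the same.\<close>
  have gd: "gdelta_in X C" if C: "C \<in> insert {} F" for C
  proof -
    consider "C = {}" | "C \<in> (\<lambda>B. topspace X - B) ` Sigma0 (Suc 0) X" | "C \<in> Pi0 2 X"
      using C sub by blast
    then show ?thesis
    proof cases
      case 2
      then have "closedin X C"
        by auto
      then show ?thesis
        using closed_imp_gdelta_in assms(1) by blast
    qed (auto simp: Pi0_2_iff_gdelta_in)
  qed
  have range: "range (from_nat_into (insert {} F)) = insert {} F"
    using F(1) by (intro range_from_nat_into) auto
  show ?thesis
  proof
    show "gdelta_in X (from_nat_into (insert {} F) n)" for n
      using gd range by blast
    show "B = (\<Union>n. from_nat_into (insert {} F) n)"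
      using range F(2) by simp
  qed
qed

section \<open>The upper bound for arbitrary second countable spaces\<close>

text \<open>Open subsets of a decided set are decided, so both quantifiers in
  \<open>monitorable_iff\<close> can be restricted to a countable pi-base.\<close>

lemma monitorable_sets_in_Pi0_3:
  assumes "second_countable X"
  shows "monitorable_sets X \<in> Pi0 3 (powerset_topology (topspace X))"
proof -
  let ?P = "powerset_topology (topspace X)"
  obtain \<B> where \<B>: "countable \<B>" "\<And>V. V \<in> \<B> \<Longrightarrow> openin X V" "\<And>V. V \<in> \<B> \<Longrightarrow> V \<noteq> {}"
    "\<And>U. openin X U \<Longrightarrow> U \<noteq> {} \<Longrightarrow> \<exists>V\<in>\<B>. V \<subseteq> U"
    using second_countable_pi_base[OF assms] by blast
  define T where "T V = {A \<in> Pow (topspace X). V \<subseteq> A \<or> V \<inter> A = {}}" for V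
  \<comment> \<open>\<open>N U\<close> collects the sets that decide no member of the pi-base below
    \<open>U\<close>. It is G-delta, and the non-monitorable sets form the countable union of all
    \<open>N U\<close>.\<close>
  define N where "N U = Pow (topspace X) - \<Union>(T ` {V \<in> \<B>. V \<subseteq> U})" for U
  have "fsigma_in ?P (\<Union>(T ` {V \<in> \<B>. V \<subseteq> U}))" for U
    unfolding T_def using \<B>(1,2) openin_subset
    by (intro fsigma_in_powerset_decided) (auto intro: countable_subset)
  then have "gdelta_in ?P (N U)" for U
    unfolding N_def by (metis gdelta_in_diff gdelta_in_topspace topspace_powerset_topology)
  then have "\<Union>(N ` \<B>) \<in> Sigma0 3 ?P"
    using \<B>(1) by (intro Union_gdelta_in_Sigma0_3) auto
  moreover have "monitorable_sets X = topspace ?P - \<Union>(N ` \<B>)"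
  proof (intro set_eqI iffI)
    fix A assume "A \<in> monitorable_sets X"
    then have A: "monitorable X A"
      by (simp add: monitorable_sets_def)
    have "A \<notin> N U" if U: "U \<in> \<B>" for U
    proof -
      obtain V where V: "openin X V" "V \<noteq> {}" "V \<subseteq> U" "V \<subseteq> A \<or> V \<inter> A = {}"
        using A \<B>(2,3)[OF U] unfolding monitorable_iff by blast
      then obtain V' where "V' \<in> \<B>" "V' \<subseteq> V"
        using \<B>(4) by blast
      then have "V' \<in> {V \<in> \<B>. V \<subseteq> U}" "A \<in> T V'"
        using V A unfolding T_def monitorable_iff by auto
      then show ?thesis
        unfolding N_def by blast
    qed
    then show "A \<in> topspace ?P - \<Union>(N ` \<B>)"
      using A by (auto simp: monitorable_iff)
  next
    fix A assume A: "A \<in> topspace ?P - \<Union>(N ` \<B>)"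
    have "\<exists>V. openin X V \<and> V \<noteq> {} \<and> V \<subseteq> U \<and> (V \<subseteq> A \<or> V \<inter> A = {})"
      if U: "openin X U" "U \<noteq> {}" for U
    proof -
      obtain U' where U': "U' \<in> \<B>" "U' \<subseteq> U"
        using \<B>(4) U by blast
      then obtain V where "V \<in> \<B>" "V \<subseteq> U'" "A \<in> T V"
        using A unfolding N_def by auto
      then show ?thesis
        using U' \<B>(2,3) unfolding T_def by (intro exI[of _ V]) auto
    qed
    then show "A \<in> monitorable_sets X"
      using A by (auto simp: monitorable_sets_def monitorable_iff)
  qed
  ultimately show ?thesis
    unfolding Pi0_def by blast
qed

subsection \<open>Spaces with finite cellularity off the minimal open sets\<close>

text \<open>Equivalently, \<open>U\<close> is an irreducible (hyperconnected) subspace.\<close>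

definition irreducible_open :: "'a topology \<Rightarrow> 'a set \<Rightarrow> bool" where
  "irreducible_open X U \<longleftrightarrow> openin X U \<and> U \<noteq> {} \<and>
     (\<forall>V W. openin X V \<and> V \<noteq> {} \<and> V \<subseteq> U \<and> openin X W \<and> W \<noteq> {} \<and> W \<subseteq> U \<longrightarrow> V \<inter> W \<noteq> {})"

text \<open>Without irreducible open sets below \<open>V\<close>, every non-empty open part of
  \<open>V\<close> splits into two disjoint ones. Splitting forever, and setting one part aside each
  time, produces an infinite disjoint family.\<close>

lemma irreducible_open_below:
  assumes fin: "\<not> infinitely_many_disjoint_opens_in X S"
    and V: "openin X V" "V \<noteq> {}" "V \<subseteq> S"
  shows "\<exists>U. irreducible_open X U \<and> U \<subseteq> V"
proof (rule ccontr)
  assume none: "\<not> (\<exists>U. irreducible_open X U \<and> U \<subseteq> V)"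
  have split: "\<exists>P Q. openin X P \<and> P \<noteq> {} \<and> P \<subseteq> W \<and> openin X Q \<and> Q \<noteq> {} \<and> Q \<subseteq> W \<and> P \<inter> Q = {}"
    if "openin X W" "W \<noteq> {}" "W \<subseteq> V" for W
  proof -
    have "\<not> irreducible_open X W"
      using none that by blast
    then show ?thesis
      using that by (simp add: irreducible_open_def)
  qed
  let ?ok = "\<lambda>W. openin X W \<and> W \<noteq> {} \<and> W \<subseteq> V"
  \<comment> \<open>In the pair \<open>s n\<close> the second component is set aside, while the
    first is split to give \<open>s (Suc n)\<close>.\<close>
  have "\<exists>s :: nat \<Rightarrow> 'a set \<times> 'a set. \<forall>n.
      (?ok (fst (s n)) \<and> ?ok (snd (s n)) \<and> fst (s n) \<inter> snd (s n) = {}) \<and>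
      (fst (s (Suc n)) \<subseteq> fst (s n) \<and> snd (s (Suc n)) \<subseteq> fst (s n))"
  proof (intro dependent_nat_choice)
    show "\<exists>p. ?ok (fst p) \<and> ?ok (snd p) \<and> fst p \<inter> snd p = {}"
      using split[of V] V by auto
    show "\<exists>q. (?ok (fst q) \<and> ?ok (snd q) \<and> fst q \<inter> snd q = {}) \<and>
        (fst q \<subseteq> fst p \<and> snd q \<subseteq> fst p)"
      if p: "?ok (fst p) \<and> ?ok (snd p) \<and> fst p \<inter> snd p = {}" for p :: "'a set \<times> 'a set" and n :: nat
    proof -
      obtain P Q where "openin X P" "P \<noteq> {}" "P \<subseteq> fst p" "openin X Q" "Q \<noteq> {}" "Q \<subseteq> fst p"
        "P \<inter> Q = {}"
        using split[of "fst p"] p by metis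
      then show ?thesis
        using that by (intro exI[of _ "(P, Q)"]) auto
    qed
  qed
  then obtain s :: "nat \<Rightarrow> 'a set \<times> 'a set" where
    ok: "\<And>n. ?ok (snd (s n))" and disj: "\<And>n. fst (s n) \<inter> snd (s n) = {}" and
    dec: "\<And>n. fst (s (Suc n)) \<subseteq> fst (s n)" and sub: "\<And>n. snd (s (Suc n)) \<subseteq> fst (s n)"
    by metis
  \<comment> \<open>The part set aside at stage \<open>j\<close> lies in the first component of
    stage \<open>j - 1\<close>, hence in that of stage \<open>i\<close>, which is disjoint from the
    part set aside there.\<close>
  have "snd (s i) \<inter> snd (s j) = {}" if ij: "i < j" for i j
  proof -
    obtain k where k: "j = Suc k" "i \<le> k"
      using ij by (metis less_Suc_eq_le less_imp_Suc_add le_add1)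
    have "snd (s j) \<subseteq> fst (s k)"
      using sub k by simp
    also have "\<dots> \<subseteq> fst (s i)"
      using lift_Suc_antimono_le[of "\<lambda>n. fst (s n)", OF dec k(2)] .
    finally show ?thesis
      using disj by blast
  qed
  then have dj: "snd (s i) \<inter> snd (s j) = {}" if "i \<noteq> j" for i j
    using that by (metis inf_commute nat_neq_iff)
  have "inj (\<lambda>n. snd (s n))"
  proof (rule injI)
    fix i j assume "snd (s i) = snd (s j)"
    then show "i = j"
      using dj[of i j] ok[of j] by auto
  qed
  then have "infinite (range (\<lambda>n. snd (s n)))"
    by (rule range_inj_infinite)
  moreover have "pairwise disjnt (range (\<lambda>n. snd (s n)))"
  proof (rule pairwiseI)
    fix A B assume "A \<in> range (\<lambda>n. snd (s n))" "B \<in> range (\<lambda>n. snd (s n))" "A \<noteq> B"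
    then obtain i j where "A = snd (s i)" "B = snd (s j)" "i \<noteq> j"
      by auto
    then show "disjnt A B"
      using dj unfolding disjnt_def by simp
  qed
  moreover have "\<forall>U\<in>range (\<lambda>n. snd (s n)). openin X U \<and> U \<subseteq> S"
    using ok V(3) by auto
  ultimately show False
    using fin unfolding infinitely_many_disjoint_opens_in_def by blast
qed

text \<open>Zorn's lemma gives a maximal disjoint family of irreducible open sets inside
  \<open>S\<close>. The hypothesis makes it finite; an open set in \<open>S\<close> missing all
  members would contain a further irreducible set, against maximality.\<close>

lemma finite_dense_irreducible_family:
  assumes fin: "\<not> infinitely_many_disjoint_opens_in X S"
  obtains \<C> where "finite \<C>" "\<And>C. C \<in> \<C> \<Longrightarrow> irreducible_open X C"
    "\<And>V. openin X V \<Longrightarrow> V \<noteq> {} \<Longrightarrow> V \<subseteq> S \<Longrightarrow> \<exists>C\<in>\<C>. V \<inter> C \<noteq> {}"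
proof -
  define \<A> where
    "\<A> = {\<C>. pairwise disjnt \<C> \<and> (\<forall>C\<in>\<C>. irreducible_open X C \<and> C \<subseteq> S)}"
  have "\<exists>M\<in>\<A>. \<forall>\<C>\<in>\<A>. M \<subseteq> \<C> \<longrightarrow> \<C> = M"
  proof (rule subset_Zorn')
    fix K assume K: "subset.chain \<A> K"
    have "pairwise disjnt (\<Union>K)"
    proof (rule pairwiseI)
      fix A B assume "A \<in> \<Union>K" "B \<in> \<Union>K" "A \<noteq> B"
      then obtain \<C> \<D> where "A \<in> \<C>" "B \<in> \<D>" "\<C> \<in> K" "\<D> \<in> K"
        by blast
      moreover have "\<C> \<subseteq> \<D> \<or> \<D> \<subseteq> \<C>"
        using K \<open>\<C> \<in> K\<close> \<open>\<D> \<in> K\<close> unfolding subset_chain_def by blast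
      moreover have "pairwise disjnt \<C>" "pairwise disjnt \<D>"
        using K \<open>\<C> \<in> K\<close> \<open>\<D> \<in> K\<close> unfolding subset_chain_def \<A>_def by blast+
      ultimately show "disjnt A B"
        using \<open>A \<noteq> B\<close> by (meson pairwiseD subsetD)
    qed
    then show "\<Union>K \<in> \<A>"
      using K unfolding subset_chain_def \<A>_def by blast
  qed
  then obtain M where M: "M \<in> \<A>" and max: "\<And>\<C>. \<C> \<in> \<A> \<Longrightarrow> M \<subseteq> \<C> \<Longrightarrow> \<C> = M"
    by blast
  show ?thesis
  proof
    show "finite M"
      using fin M unfolding infinitely_many_disjoint_opens_in_def \<A>_def irreducible_open_def
      by blast
    show "irreducible_open X C" if "C \<in> M" for C
      using M that unfolding \<A>_def by blast
    show "\<exists>C\<in>M. V \<inter> C \<noteq> {}" if V: "openin X V" "V \<noteq> {}" "V \<subseteq> S" for V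
    proof (rule ccontr)
      assume no: "\<not> (\<exists>C\<in>M. V \<inter> C \<noteq> {})"
      obtain U where U: "irreducible_open X U" "U \<subseteq> V"
        using irreducible_open_below[OF fin V] by blast
      have "disjnt U C" "disjnt C U" if "C \<in> M" for C
        using no U(2) that unfolding disjnt_def by blast+
      moreover have "U \<subseteq> S"
        using U(2) V(3) by blast
      ultimately have "insert U M \<in> \<A>"
        using M U(1) unfolding \<A>_def by (simp add: pairwise_insert)
      then have "U \<in> M"
        using max by blast
      then show False
        using no U unfolding irreducible_open_def by blast
    qed
  qed
qed

text \<open>The factor \<open>topspace Z\<close> takes care of the empty family, whose intersection
  is the whole type.\<close>

lemma fsigma_in_finite_Inter:
  assumes "finite \<C>" "\<And>C. C \<in> \<C> \<Longrightarrow> fsigma_in Z (F C)"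
  shows "fsigma_in Z (topspace Z \<inter> \<Inter>(F ` \<C>))"
  using assms
proof (induction \<C>)
  case (insert C \<C>)
  have "topspace Z \<inter> \<Inter>(F ` insert C \<C>) = F C \<inter> (topspace Z \<inter> \<Inter>(F ` \<C>))"
    by auto
  then show ?case
    using insert by (simp add: fsigma_in_Int)
qed simp

text \<open>Deciding all minimal open sets is a closed condition, however many there are. Deciding
  something below a given irreducible set is F-sigma, and only finitely many such conditions are
  imposed.\<close>

lemma monitorable_sets_in_Sigma0_2:
  assumes sc: "second_countable X"
    and fin: "\<not> infinitely_many_disjoint_opens_in X (topspace X - \<Union>{U. minimal_open X U})"
  shows "monitorable_sets X \<in> Sigma0 2 (powerset_topology (topspace X))"
proof -
  let ?P = "powerset_topology (topspace X)"
  obtain \<B> where \<B>: "countable \<B>" "\<And>V. V \<in> \<B> \<Longrightarrow> openin X V" "\<And>V. V \<in> \<B> \<Longrightarrow> V \<noteq> {}"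
    "\<And>U. openin X U \<Longrightarrow> U \<noteq> {} \<Longrightarrow> \<exists>V\<in>\<B>. V \<subseteq> U"
    using second_countable_pi_base[OF sc] by blast
  obtain \<C> where \<C>: "finite \<C>" "\<And>C. C \<in> \<C> \<Longrightarrow> irreducible_open X C"
    "\<And>V. openin X V \<Longrightarrow> V \<noteq> {} \<Longrightarrow> V \<subseteq> topspace X - \<Union>{U. minimal_open X U} \<Longrightarrow>
       \<exists>C\<in>\<C>. V \<inter> C \<noteq> {}"
    using finite_dense_irreducible_family[OF fin] by blast
  define T where "T V = {A \<in> Pow (topspace X). V \<subseteq> A \<or> V \<inter> A = {}}" for V
  define F where "F C = \<Union>(T ` {V \<in> \<B>. V \<subseteq> C})" for C
  \<comment> \<open>The full powerset keeps the intersected family non-empty when there are no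
    minimal open sets.\<close>
  define J where "J = \<Inter>(insert (Pow (topspace X)) (T ` {U. minimal_open X U}))"
  have "closedin ?P J"
    unfolding J_def
  proof (rule closedin_Inter)
    fix S assume "S \<in> insert (Pow (topspace X)) (T ` {U. minimal_open X U})"
    then show "closedin ?P S"
      using closedin_topspace[of ?P] closedin_powerset_decided[OF openin_subset]
      unfolding T_def minimal_open_def by auto
  qed simp
  moreover have "fsigma_in ?P (F C)" for C
    unfolding F_def T_def using \<B>(1,2) openin_subset
    by (intro fsigma_in_powerset_decided) (auto intro: countable_subset)
  ultimately have "fsigma_in ?P (J \<inter> (topspace ?P \<inter> \<Inter>(F ` \<C>)))"
    using fsigma_in_Int[OF closed_imp_fsigma_in fsigma_in_finite_Inter[OF \<C>(1)]] by blast
  moreover have "monitorable_sets X = J \<inter> (topspace ?P \<inter> \<Inter>(F ` \<C>))"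
  proof (intro set_eqI iffI)
    fix A assume "A \<in> monitorable_sets X"
    then have sub: "A \<subseteq> topspace X"
      and A: "\<And>U. openin X U \<Longrightarrow> U \<noteq> {} \<Longrightarrow>
        \<exists>V. openin X V \<and> V \<noteq> {} \<and> V \<subseteq> U \<and> (V \<subseteq> A \<or> V \<inter> A = {})"
      by (auto simp: monitorable_sets_def monitorable_iff)
    have "A \<in> T U" if U: "minimal_open X U" for U
    proof -
      have "openin X U" "U \<noteq> {}"
        using U unfolding minimal_open_def by auto
      then obtain V where V: "openin X V" "V \<noteq> {}" "V \<subseteq> U" "V \<subseteq> A \<or> V \<inter> A = {}"
        using A[of U] by metis
      then have "V = U"
        using U unfolding minimal_open_def by simp
      then show ?thesis
        using sub V(4) unfolding T_def by simp
    qed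
    then have "A \<in> J"
      using sub unfolding J_def by auto
    moreover have "A \<in> F C" if C: "C \<in> \<C>" for C
    proof -
      obtain V where V: "openin X V" "V \<noteq> {}" "V \<subseteq> C" "V \<subseteq> A \<or> V \<inter> A = {}"
        using A[of C] \<C>(2)[OF C] unfolding irreducible_open_def by metis
      then obtain V' where "V' \<in> \<B>" "V' \<subseteq> V"
        using \<B>(4) by blast
      with V sub have "V' \<in> {V \<in> \<B>. V \<subseteq> C}" "A \<in> T V'"
        unfolding T_def by auto
      then show ?thesis
        unfolding F_def by blast
    qed
    ultimately show "A \<in> J \<inter> (topspace ?P \<inter> \<Inter>(F ` \<C>))"
      using sub by auto
  next
    fix A assume A: "A \<in> J \<inter> (topspace ?P \<inter> \<Inter>(F ` \<C>))"
    have "\<exists>V. openin X V \<and> V \<noteq> {} \<and> V \<subseteq> U \<and> (V \<subseteq> A \<or> V \<inter> A = {})"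
      if U: "openin X U" "U \<noteq> {}" for U
    proof (cases "U \<inter> \<Union>{U. minimal_open X U} = {}")
      case True
      then have "U \<subseteq> topspace X - \<Union>{U. minimal_open X U}"
        using openin_subset[OF U(1)] by blast
      then obtain C where C: "C \<in> \<C>" "U \<inter> C \<noteq> {}"
        using \<C>(3) U by blast
      then have "A \<in> F C"
        using A by blast
      then obtain V where V: "V \<in> \<B>" "V \<subseteq> C" "A \<in> T V"
        unfolding F_def by blast
      have irr: "irreducible_open X C"
        using \<C>(2) C by blast
      then have "openin X (U \<inter> C)"
        using U unfolding irreducible_open_def by blast
      \<comment> \<open>The decided \<open>V\<close> below \<open>C\<close> was chosen independently
        of \<open>U\<close>; irreducibility of \<open>C\<close> makes it meet \<open>U\<close>, and
        then \<open>U \<inter> V\<close> is a decided part of \<open>U\<close>.\<close>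
      then have "(U \<inter> C) \<inter> V \<noteq> {}"
        using irr C(2) V(2) \<B>(2,3)[OF V(1)] unfolding irreducible_open_def by simp
      moreover have "openin X (U \<inter> V)"
        using U V \<B>(2) by blast
      ultimately show ?thesis
        using V(3) unfolding T_def by (intro exI[of _ "U \<inter> V"]) auto
    next
      case False
      then obtain W where W: "minimal_open X W" "U \<inter> W \<noteq> {}"
        by blast
      \<comment> \<open>By minimality, an open set meeting \<open>W\<close> contains it.\<close>
      then have "U \<inter> W = W"
        using U unfolding minimal_open_def by (meson inf_le2 openin_Int)
      moreover have "A \<in> T W"
        using A W unfolding J_def by blast
      ultimately show ?thesis
        using W(1) unfolding T_def minimal_open_def by (intro exI[of _ W]) auto
    qed
    then show "A \<in> monitorable_sets X"
      using A by (auto simp: monitorable_sets_def monitorable_iff)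
  qed
  ultimately show ?thesis
    by (simp add: Sigma0_2_iff_fsigma_in)
qed

subsection \<open>Zero-dimensional Polish spaces\<close>

text \<open>The balls of radius \<open>1 / (n + 1)\<close> around the points of a countable dense
  set form a base.\<close>

lemma separable_metrizable_imp_second_countable:
  assumes "metrizable_space Y" "separable_space Y"
  shows "second_countable Y"
proof -
  obtain M d where "Metric_space M d" and Y: "Y = Metric_space.mtopology M d"
    using assms(1) unfolding metrizable_space_def by blast
  then interpret Metric_space M d
    by simp
  obtain C where C: "countable C" "C \<subseteq> M" "mtopology closure_of C = M"
    using assms(2) unfolding separable_space_def Y by auto
  define \<B> where "\<B> = (\<lambda>(c, n). mball c (inverse (real (Suc n)))) ` (C \<times> UNIV)"
  have "\<exists>V\<in>\<B>. x \<in> V \<and> V \<subseteq> U" if U: "openin mtopology U" "x \<in> U" for U x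
  proof -
    have x: "x \<in> M"
      using U openin_subset by fastforce
    obtain r where r: "r > 0" "mball x r \<subseteq> U"
      using U unfolding openin_mtopology by blast
    obtain n where n: "inverse (real (Suc n)) < r / 2"
      using r reals_Archimedean[of "r / 2"] by auto
    have "openin mtopology (mball x (inverse (real (Suc n))))"
      by (rule openin_mball)
    moreover have "x \<in> mball x (inverse (real (Suc n)))"
      using x by simp
    ultimately obtain c where c: "c \<in> C" "c \<in> mball x (inverse (real (Suc n)))"
      using x C(3) unfolding in_closure_of set_eq_iff by blast
    have "mball c (inverse (real (Suc n))) \<subseteq> mball x r"
    proof
      fix z assume z: "z \<in> mball c (inverse (real (Suc n)))"
      have "d x z \<le> d x c + d c z"
        using x z by (intro triangle) auto
      also have "\<dots> < r"
        using c z n by auto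
      finally show "z \<in> mball x r"
        using x z by auto
    qed
    moreover have "x \<in> mball c (inverse (real (Suc n)))"
      using c by (simp add: commute)
    moreover have "mball c (inverse (real (Suc n))) \<in> \<B>"
      unfolding \<B>_def using c(1) by force
    ultimately show ?thesis
      using r(2) by (meson order_trans)
  qed
  moreover have "countable \<B>"
    unfolding \<B>_def using C(1) by simp
  moreover have "\<forall>V\<in>\<B>. openin mtopology V"
    unfolding \<B>_def by auto
  ultimately show ?thesis
    unfolding second_countable_def Y by (intro exI[of _ \<B>]) auto
qed

text \<open>Cover \<open>U\<close> by countably many clopen subsets and subtract from each the
  finitely many earlier ones, which keeps the pieces clopen.\<close>

lemma open_eq_disjoint_Union_clopen:
  assumes "second_countable Y" "Y dim_le 0" "openin Y U"
  obtains K :: "nat \<Rightarrow> 'a set" where "\<And>i. openin Y (K i)" "\<And>i. closedin Y (K i)"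
    "disjoint_family K" "(\<Union>i. K i) = U"
proof -
  obtain \<B> where \<B>: "countable \<B>" "\<forall>V\<in>\<B>. openin Y V"
    "\<forall>U x. openin Y U \<and> x \<in> U \<longrightarrow> (\<exists>V\<in>\<B>. x \<in> V \<and> V \<subseteq> U)"
    using assms(1) unfolding second_countable_def by blast
  \<comment> \<open>Choosing one clopen set per suitable base element, not per point, keeps the
    cover countable.\<close>
  define \<V> where "\<V> = {V \<in> \<B>. \<exists>C. openin Y C \<and> closedin Y C \<and> V \<subseteq> C \<and> C \<subseteq> U}"
  have "\<forall>V\<in>\<V>. \<exists>C. openin Y C \<and> closedin Y C \<and> V \<subseteq> C \<and> C \<subseteq> U"
    unfolding \<V>_def by blast
  then obtain c where c: "\<And>V. V \<in> \<V> \<Longrightarrow> openin Y (c V) \<and> closedin Y (c V) \<and> V \<subseteq> c V \<and> c V \<subseteq> U"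
    by metis
  have cover: "\<exists>V\<in>\<V>. x \<in> V" if x: "x \<in> U" for x
  proof -
    obtain C D where C: "openin Y C" "x \<in> C" "C \<subseteq> D" "openin Y D" "closedin Y D" "D \<subseteq> U"
      using assms(2,3) x openin_subset[OF assms(3)]
      unfolding dimension_le_0_neighbourhood_base_of_clopen neighbourhood_base_of_def neighbourhood_base_at_def
      by (metis subsetD)
    then obtain V where "V \<in> \<B>" "x \<in> V" "V \<subseteq> C"
      using \<B>(3) by blast
    then have "V \<in> \<V>"
      unfolding \<V>_def using C by blast
    then show ?thesis
      using \<open>x \<in> V\<close> by blast
  qed
  define E where "E = from_nat_into (insert {} (c ` \<V>))"
  have rangeE: "range E = insert {} (c ` \<V>)"
    unfolding E_def \<V>_def using \<B>(1) by (intro range_from_nat_into) auto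
  have E: "openin Y (E i)" "closedin Y (E i)" "E i \<subseteq> U" for i
  proof -
    have "E i \<in> insert {} (c ` \<V>)"
      using rangeE by blast
    then show "openin Y (E i)" "closedin Y (E i)" "E i \<subseteq> U"
      using c by auto
  qed
  have "x \<in> \<Union>(range E)" if x: "x \<in> U" for x
  proof -
    obtain V where "V \<in> \<V>" "x \<in> V"
      using cover[OF x] by blast
    then have "c V \<in> range E" "x \<in> c V"
      unfolding rangeE using c by auto
    then show ?thesis
      by (rule UnionI)
  qed
  then have UE: "(\<Union>i. E i) = U"
    using E(3) by auto
  show ?thesis
  proof
    show "disjoint_family (disjointed E)"
      by (rule disjoint_family_disjointed)
    show "(\<Union>i. disjointed E i) = U"
      using UE by (simp add: UN_disjointed_eq)
    have fin: "openin Y (\<Union>(E ` {0..<i})) \<and> closedin Y (\<Union>(E ` {0..<i}))" for i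
      using E by (intro conjI openin_Union closedin_Union) auto
    then show "openin Y (disjointed E i)" "closedin Y (disjointed E i)" for i
      unfolding disjointed_def using E by (auto intro: openin_diff closedin_diff)
  qed
qed

text \<open>Cut the \<open>m\<close>-th set of a decreasing sequence of open sets into disjoint clopen pieces:
  a point of the intersection lies in one piece for every \<open>m\<close>, any other point in finitely many
  pieces altogether.\<close>

lemma gdelta_in_eq_limsup_clopen:
  assumes "second_countable Y" "Y dim_le 0" "gdelta_in Y G"
  shows "\<exists>K :: nat \<Rightarrow> 'a set. (\<forall>k. openin Y (K k) \<and> closedin Y (K k)) \<and>
           G = {y. infinite {k. y \<in> K k}}"
proof -
  obtain U where U: "\<And>m. openin Y (U m)" "\<And>m. U (Suc m) \<subseteq> U m" "\<Inter>(range U) = G"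
    using assms(3) unfolding gdelta_in_descending by blast
  have "\<exists>K :: nat \<Rightarrow> 'a set. (\<forall>i. openin Y (K i) \<and> closedin Y (K i)) \<and> disjoint_family K \<and>
      (\<Union>i. K i) = U m" for m
    using open_eq_disjoint_Union_clopen[OF assms(1,2) U(1)[of m]] by metis
  then obtain K :: "nat \<Rightarrow> nat \<Rightarrow> 'a set" where
    K: "\<And>m i. openin Y (K m i)" "\<And>m i. closedin Y (K m i)" "\<And>m. disjoint_family (K m)"
      "\<And>m. (\<Union>i. K m i) = U m"
    by metis
  define N where "N y = {(m, i). y \<in> K m i}" for y
  have "infinite (N y) \<longleftrightarrow> y \<in> G" for y
  proof
    assume y: "y \<in> G"
    then have "m \<in> fst ` N y" for m
    proof -
      have "y \<in> (\<Union>i. K m i)"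
        using y U(3) K(4) by blast
      then show ?thesis
        unfolding N_def by force
    qed
    then have "fst ` N y = UNIV"
      by auto
    then show "infinite (N y)"
      by (metis finite_imageI infinite_UNIV_nat)
  next
    assume inf: "infinite (N y)"
    show "y \<in> G"
    proof (rule ccontr)
      assume "y \<notin> G"
      then obtain m0 where m0: "y \<notin> U m0"
        using U(3) by blast
      have "m < m0" if "(m, i) \<in> N y" for m i
      proof (rule ccontr)
        assume "\<not> m < m0"
        then have "U m \<subseteq> U m0"
          using lift_Suc_antimono_le[of U m0 m] U(2) by simp
        moreover have "y \<in> U m"
          using that K(4)[of m] unfolding N_def by blast
        ultimately show False
          using m0 by blast
      qed
      then have "fst ` N y \<subseteq> {..<m0}"
        by auto
      \<comment> \<open>For fixed \<open>m\<close> the pieces are disjoint, so \<open>m\<close>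
        determines the piece containing \<open>y\<close>.\<close>
      moreover have "inj_on fst (N y)"
        using K(3) unfolding N_def inj_on_def disjoint_family_on_def by fastforce
      ultimately show False
        using inf by (metis finite_imageD finite_lessThan finite_subset)
    qed
  qed
  \<comment> \<open>The double sequence is turned into a single one by coding pairs; the coding is
    bijective and preserves finiteness.\<close>
  moreover have "finite {k. prod_decode k \<in> N y} \<longleftrightarrow> finite (N y)" for y
  proof -
    have "bij_betw prod_decode {k. prod_decode k \<in> N y} (N y)"
      using bij_prod_decode unfolding bij_betw_def
      by (auto intro: inj_on_subset) (metis imageI mem_Collect_eq prod_encode_inverse)
    then show ?thesis
      by (rule bij_betw_finite)
  qed
  ultimately have "G = {y. infinite {k. y \<in> case_prod K (prod_decode k)}}"
    unfolding N_def by (auto simp: case_prod_unfold)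
  then show ?thesis
    using K(1,2) by (intro exI[of _ "\<lambda>k. case_prod K (prod_decode k)"]) (auto simp: case_prod_unfold)
qed

subsection \<open>Spaces without minimal open sets\<close>

text \<open>It suffices to find one such point in every non-empty open part of \<open>S\<close>: if
  those in \<open>V\<close> were finitely many, they would form a nowhere dense set, and some open
  part of \<open>V\<close> would contain none.\<close>

lemma infinite_nowhere_dense_points:
  assumes nomin: "\<And>W. minimal_open X W \<Longrightarrow> \<not> W \<subseteq> S"
    and V: "openin X V" "V \<noteq> {}" "V \<subseteq> S"
  shows "infinite {x \<in> V. nowhere_dense_in X {x}}"
proof
  have ex: "\<exists>x\<in>V. nowhere_dense_in X {x}" if V: "openin X V" "V \<noteq> {}" "V \<subseteq> S" for V
  proof (rule ccontr)
    assume none: "\<not> (\<exists>x\<in>V. nowhere_dense_in X {x})"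
    \<comment> \<open>If \<open>{x}\<close> is not nowhere dense, \<open>x\<close> lies in all
      non-empty open subsets of some \<open>W\<close>.\<close>
    have trap: "\<exists>W. openin X W \<and> W \<noteq> {} \<and> (\<forall>W'. openin X W' \<and> W' \<noteq> {} \<and> W' \<subseteq> W \<longrightarrow> x \<in> W')"
      if "x \<in> V" for x
    proof -
      have "\<not> nowhere_dense_in X {x}"
        using none that by blast
      then show ?thesis
        unfolding nowhere_dense_in_def by simp metis
    qed
    obtain a where a: "a \<in> V"
      using V by blast
    then obtain W where W: "openin X W" "W \<noteq> {}"
      "\<And>W'. openin X W' \<Longrightarrow> W' \<noteq> {} \<Longrightarrow> W' \<subseteq> W \<Longrightarrow> a \<in> W'"
      using trap[of a] by metis
    have "a \<in> W"
      using W by blast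
    then have "openin X (V \<inter> W)" "V \<inter> W \<noteq> {}"
      using a V W by auto
    moreover have "\<not> minimal_open X (V \<inter> W)"
      using nomin[of "V \<inter> W"] V by blast
    ultimately obtain V' where V': "openin X V'" "V' \<noteq> {}" "V' \<subseteq> V \<inter> W" "V' \<noteq> V \<inter> W"
      unfolding minimal_open_def by metis
    \<comment> \<open>Two trapped points exclude each other: \<open>W2 \<inter> W\<close> contains
      \<open>b\<close> and hence \<open>a\<close>; so does \<open>V'\<close>. Thus
      \<open>W2 \<inter> V'\<close> is a non-empty open part of \<open>W2\<close> and must contain
      \<open>b\<close>, although \<open>b\<close> was taken outside \<open>V'\<close>.\<close>
    then obtain b where b: "b \<in> V" "b \<in> W" "b \<notin> V'"
      by blast
    obtain W2 where W2: "openin X W2" "W2 \<noteq> {}"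
      "\<And>W'. openin X W' \<Longrightarrow> W' \<noteq> {} \<Longrightarrow> W' \<subseteq> W2 \<Longrightarrow> b \<in> W'"
      using trap[OF b(1)] by metis
    have "b \<in> W2"
      using W2 by blast
    then have "a \<in> W2 \<inter> W"
      using W(3)[of "W2 \<inter> W"] W(1) W2(1) b by blast
    moreover have "a \<in> V'"
      using W(3) V' by blast
    ultimately have "b \<in> W2 \<inter> V'"
      using W2(3)[of "W2 \<inter> V'"] V'(1) W2(1) by blast
    then show False
      using b by blast
  qed
  assume "finite {x \<in> V. nowhere_dense_in X {x}}"
  then have "nowhere_dense_in X {x \<in> V. nowhere_dense_in X {x}}"
    by (rule nowhere_dense_in_finite) simp
  then obtain W where "openin X W" "W \<noteq> {}" "W \<subseteq> V" "W \<inter> {x \<in> V. nowhere_dense_in X {x}} = {}"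
    using V(1,2) by (rule nowhere_dense_inE)
  then show False
    using ex[of W] V(3) by blast
qed

text \<open>Choose greedily: at stage \<open>i\<close> only finitely many points of
  \<open>W i\<close> have been used.\<close>

lemma distinct_representatives:
  fixes W :: "nat \<Rightarrow> 'a set"
  assumes "\<And>i. infinite (W i)"
  obtains p where "inj p" "\<And>i. p i \<in> W i"
proof -
  have "\<exists>p. \<forall>i. p i \<in> W i \<and> p i \<notin> p ` {..<i}"
  proof (rule dependent_wellorder_choice)
    fix r :: 'a and f g :: "nat \<Rightarrow> 'a" and i
    assume "\<And>j. j < i \<Longrightarrow> f j = g j"
    then have "f ` {..<i} = g ` {..<i}"
      by auto
    then show "(r \<in> W i \<and> r \<notin> f ` {..<i}) = (r \<in> W i \<and> r \<notin> g ` {..<i})"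
      by simp
  next
    fix i and f :: "nat \<Rightarrow> 'a"
    have "infinite (W i - f ` {..<i})"
      using assms by (simp add: Diff_infinite_finite)
    then have "W i - f ` {..<i} \<noteq> {}"
      by (metis finite.emptyI)
    then show "\<exists>r. r \<in> W i \<and> r \<notin> f ` {..<i}"
      by blast
  qed
  then obtain p where p: "\<And>i. p i \<in> W i" "\<And>i. p i \<notin> p ` {..<i}"
    by blast
  have "inj p"
  proof (rule linorder_injI)
    show "p i \<noteq> p j" if "i < j" for i j
      using p(2)[of j] that by (metis imageI lessThan_iff)
  qed
  with p(1) show ?thesis
    using that by blast
qed

lemma finite_blocks:
  assumes sc: "second_countable X"
    and nomin: "\<And>W. minimal_open X W \<Longrightarrow> \<not> W \<subseteq> S"
  obtains D :: "nat \<Rightarrow> 'a set" where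
    "\<And>k. finite (D k)" "disjoint_family D"
    "\<And>k x. x \<in> D k \<Longrightarrow> nowhere_dense_in X {x}"
    "\<And>V. openin X V \<Longrightarrow> V \<noteq> {} \<Longrightarrow> V \<subseteq> S \<Longrightarrow> finite {k. D k \<inter> V = {}}"
proof -
  obtain \<B> where \<B>: "countable \<B>" "\<And>V. V \<in> \<B> \<Longrightarrow> openin X V" "\<And>V. V \<in> \<B> \<Longrightarrow> V \<noteq> {}"
    "\<And>U. openin X U \<Longrightarrow> U \<noteq> {} \<Longrightarrow> \<exists>V\<in>\<B>. V \<subseteq> U"
    using second_countable_pi_base[OF sc] by blast
  define \<B>' where "\<B>' = {V \<in> \<B>. V \<subseteq> S}"
  show ?thesis
  proof (cases "\<B>' = {}")
    case True
    \<comment> \<open>Here \<open>S\<close> contains no non-empty open set, so empty blocks satisfy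
      the last property vacuously.\<close>
    show ?thesis
    proof (rule that[of "\<lambda>_. {}"])
      show "finite {k :: nat. {} \<inter> V = {}}" if V: "openin X V" "V \<noteq> {}" "V \<subseteq> S" for V :: "'a set"
        using \<B>(4)[OF V(1,2)] V(3) True unfolding \<B>'_def by blast
    qed (auto simp: disjoint_family_on_def)
  next
    case False
    define v where "v = from_nat_into \<B>'"
    have range_v: "range v = \<B>'"
      unfolding v_def \<B>'_def using \<B>(1) False[unfolded \<B>'_def] by (intro range_from_nat_into) auto
    \<comment> \<open>The first coordinate of the decoded pair runs through each index infinitely
      often, so every \<open>v j\<close> receives infinitely many distinct points.\<close>
    define W where "W i = {x \<in> v (fst (prod_decode i)). nowhere_dense_in X {x}}" for i
    have "infinite (W i)" for i
    proof -
      have "v (fst (prod_decode i)) \<in> \<B>'"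
        using range_v by blast
      then show ?thesis
        unfolding W_def \<B>'_def using nomin \<B>(2,3) by (intro infinite_nowhere_dense_points) auto
    qed
    then obtain p where p: "inj p" "\<And>i. p i \<in> W i"
      using distinct_representatives[of W] by blast
    \<comment> \<open>Block \<open>k\<close> takes one point from each of \<open>v 0\<close>, ...,
      \<open>v k\<close>; hence it is finite, and \<open>v j\<close> is met by all blocks from index
      \<open>j\<close> on.\<close>
    define D where "D k = (\<lambda>j. p (prod_encode (j, k))) ` {..k}" for k
    show ?thesis
    proof (rule that[of D])
      show "finite (D k)" for k
        unfolding D_def by simp
      show "disjoint_family D"
        unfolding disjoint_family_on_def D_def using p(1) by (auto simp: inj_eq)
      show "nowhere_dense_in X {x}" if "x \<in> D k" for k x
        using that p(2) unfolding D_def W_def by auto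
      show "finite {k. D k \<inter> V = {}}" if V: "openin X V" "V \<noteq> {}" "V \<subseteq> S" for V
      proof -
        obtain U where "U \<in> \<B>'" "U \<subseteq> V"
          using \<B>(4)[OF V(1,2)] V(3) unfolding \<B>'_def by blast
        then obtain j where j: "v j \<subseteq> V"
          using range_v by (metis imageE)
        have "D k \<inter> V \<noteq> {}" if "j \<le> k" for k
        proof -
          have "p (prod_encode (j, k)) \<in> D k"
            unfolding D_def using that by auto
          moreover have "p (prod_encode (j, k)) \<in> V"
            using p(2)[of "prod_encode (j, k)"] j unfolding W_def by auto
          ultimately show ?thesis
            by blast
        qed
        then have "{k. D k \<inter> V = {}} \<subseteq> {..<j}"
          by (auto simp: not_less[symmetric])
        then show ?thesis
          using finite_subset by blast
      qed
    qed
  qed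
qed

text \<open>Only the even blocks are ever used, so that the odd ones keep the constructed set codense.\<close>

lemma monitorable_blocks_iff:
  assumes S: "\<And>n. openin X (U n)" "\<And>n. U n \<noteq> {}" "\<And>n. U n \<subseteq> S" "disjoint_family U"
    and D: "\<And>k. finite (D k)" "disjoint_family D"
    "\<And>k x. x \<in> D k \<Longrightarrow> nowhere_dense_in X {x}"
    "\<And>V. openin X V \<Longrightarrow> V \<noteq> {} \<Longrightarrow> V \<subseteq> S \<Longrightarrow> finite {k. D k \<inter> V = {}}"
    and A: "A = (\<Union>n. \<Union>k\<in>I n. D (2 * k) \<inter> U n)"
  shows "monitorable X A \<longleftrightarrow> (\<forall>n. finite (I n :: nat set))"
proof
  assume mon: "monitorable X A"
  show "\<forall>n. finite (I n)"
  proof (rule ccontr)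
    assume "\<not> (\<forall>n. finite (I n))"
    then obtain n where inf: "infinite (I n)"
      by blast
    obtain V where V: "openin X V" "V \<noteq> {}" "V \<subseteq> U n" "V \<subseteq> A \<or> V \<inter> A = {}"
      using mon S(1,2)[of n] unfolding monitorable_iff by metis
    then have fin: "finite {k. D k \<inter> V = {}}"
      using D(4) S(3) by blast
    \<comment> \<open>\<open>V\<close> meets almost all blocks. An even block with index in
      \<open>I n\<close> puts a point of \<open>A\<close> into \<open>V\<close> and forces
      \<open>V \<subseteq> A\<close>; an odd block then gives a point of \<open>V\<close> outside
      \<open>A\<close>.\<close>
    have "infinite ((\<lambda>k. 2 * k) ` I n)"
      using inf by (simp add: finite_image_iff inj_on_def)
    then obtain k where "k \<in> I n" "D (2 * k) \<inter> V \<noteq> {}"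
      using fin by (metis (mono_tags, lifting) finite_subset imageE mem_Collect_eq subsetI)
    then have "V \<inter> A \<noteq> {}"
      unfolding A using V(3) by blast
    then have "V \<subseteq> A"
      using V(4) by blast
    have "infinite (range (\<lambda>k :: nat. 2 * k + 1))"
      by (intro range_inj_infinite injI) simp
    then obtain k where "D (2 * k + 1) \<inter> V \<noteq> {}"
      using fin by (metis (mono_tags, lifting) finite_subset imageE mem_Collect_eq subsetI)
    then obtain x where x: "x \<in> D (2 * k + 1)" "x \<in> A"
      using \<open>V \<subseteq> A\<close> by blast
    then obtain l where "x \<in> D (2 * l)"
      unfolding A by blast
    moreover have "D (2 * l) \<inter> D (2 * k + 1) = {}"
    proof -
      have "2 * l \<noteq> 2 * k + 1"
        by presburger
      then show ?thesis
        using D(2) unfolding disjoint_family_on_def by blast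
    qed
    ultimately show False
      using x by blast
  qed
next
  assume fin: "\<forall>n. finite (I n)"
  have "A \<subseteq> topspace X"
    unfolding A using openin_subset[OF S(1)] by blast
  moreover have "\<exists>W. openin X W \<and> W \<noteq> {} \<and> W \<subseteq> V \<and> (W \<subseteq> A \<or> W \<inter> A = {})"
    if V: "openin X V" "V \<noteq> {}" for V
  proof (cases "\<exists>n. V \<inter> U n \<noteq> {}")
    case False
    then have "V \<inter> A = {}"
      unfolding A by auto
    then show ?thesis
      using V by (intro exI[of _ V]) auto
  next
    case True
    then obtain n where n: "V \<inter> U n \<noteq> {}"
      by blast
    \<comment> \<open>By disjointness of the \<open>U n\<close>, only the blocks indexed by
      \<open>I n\<close> contribute inside \<open>U n\<close>; finitely many of them give a nowhere
      dense set, so \<open>V \<inter> U n\<close> has a part missing \<open>A\<close>.\<close>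
    have eq: "A \<inter> U n = (\<Union>k\<in>I n. D (2 * k) \<inter> U n)"
    proof -
      have meet: "U m \<inter> U n = (if m = n then U n else {})" for m
        using S(4) unfolding disjoint_family_on_def by auto
      have "A \<inter> U n = (\<Union>m. \<Union>k\<in>I m. D (2 * k) \<inter> (U m \<inter> U n))"
        unfolding A by auto
      also have "\<dots> = (\<Union>k\<in>I n. D (2 * k) \<inter> U n)"
        unfolding meet by (auto split: if_splits)
      finally show ?thesis .
    qed
    have "finite (A \<inter> U n)"
      unfolding eq using fin D(1) by auto
    moreover have "nowhere_dense_in X {x}" if "x \<in> A \<inter> U n" for x
      using that D(3) unfolding eq by blast
    ultimately have "nowhere_dense_in X (A \<inter> U n)"
      by (rule nowhere_dense_in_finite)
    moreover have "openin X (V \<inter> U n)"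
      using V S(1) by blast
    ultimately obtain W where "openin X W" "W \<noteq> {}" "W \<subseteq> V \<inter> U n" "W \<inter> (A \<inter> U n) = {}"
      using n by (elim nowhere_dense_inE)
    then show ?thesis
      by (intro exI[of _ W]) auto
  qed
  ultimately show "monitorable X A"
    unfolding monitorable_iff by simp
qed

section \<open>The reduction and the dichotomy\<close>

lemma infinitely_many_disjoint_opens_in_sequence:
  assumes "infinitely_many_disjoint_opens_in X S"
  obtains U :: "nat \<Rightarrow> 'a set" where
    "\<And>n. openin X (U n)" "\<And>n. U n \<noteq> {}" "\<And>n. U n \<subseteq> S" "disjoint_family U"
proof -
  obtain \<U> where \<U>: "infinite \<U>" "pairwise disjnt \<U>" "\<forall>U\<in>\<U>. openin X U \<and> U \<subseteq> S"
    using assms unfolding infinitely_many_disjoint_opens_in_def by blast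
  have "infinite (\<U> - {{}})"
    using \<U>(1) by simp
  then obtain U :: "nat \<Rightarrow> 'a set" where U: "inj U" "range U \<subseteq> \<U> - {{}}"
    using infinite_countable_subset by blast
  then have mem: "U n \<in> \<U>" "U n \<noteq> {}" for n
    by blast+
  show ?thesis
  proof
    show "openin X (U n)" "U n \<noteq> {}" "U n \<subseteq> S" for n
      using \<U>(3) mem by auto
    show "disjoint_family U"
      unfolding disjoint_family_on_def
    proof (intro ballI impI)
      fix m n :: nat assume "m \<noteq> n"
      then have "U m \<noteq> U n"
        using U(1) by (simp add: inj_eq)
      then show "U m \<inter> U n = {}"
        using \<U>(2) mem unfolding pairwise_def disjnt_def by blast
    qed
  qed
qed

text \<open>The complement of \<open>B\<close> is a union of G-delta sets \<open>G n\<close>, each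
  the limsup of clopen sets \<open>K n k\<close>. So \<open>y\<close> lies in \<open>B\<close> iff
  all index sets \<open>{k. y \<in> K n k}\<close> are finite, which is the condition in
  \<open>monitorable_blocks_iff\<close>.\<close>

lemma monitorable_sets_Pi0_3_hard:
  fixes X :: "'a topology"
  assumes sc: "second_countable X"
    and inf: "infinitely_many_disjoint_opens_in X S"
    and nomin: "\<And>W. minimal_open X W \<Longrightarrow> \<not> W \<subseteq> S"
  shows "Pi0_hard TYPE('y) 3 (powerset_topology (topspace X)) (monitorable_sets X)"
  unfolding Pi0_hard_def
proof (intro allI impI)
  fix Y :: "'y topology" and B
  assume "Polish_space Y \<and> Y dim_le 0 \<and> B \<in> Pi0 3 Y"
  then have met: "metrizable_space Y" and sep: "separable_space Y" and dim: "Y dim_le 0"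
    and B: "B \<in> Pi0 3 Y"
    by (auto simp: Polish_space_def completely_metrizable_imp_metrizable_space)
  have scY: "second_countable Y"
    using met sep by (rule separable_metrizable_imp_second_countable)
  obtain B' where B': "B' \<in> Sigma0 3 Y" "B = topspace Y - B'"
    using B unfolding Pi0_def by blast
  obtain G :: "nat \<Rightarrow> 'y set" where G: "\<And>n. gdelta_in Y (G n)" "B' = (\<Union>n. G n)"
    using Sigma0_3_gdelta_in_sequence[OF met B'(1)] by metis
  obtain K :: "nat \<Rightarrow> nat \<Rightarrow> 'y set" where
    K: "\<And>n k. openin Y (K n k) \<and> closedin Y (K n k)" "\<And>n. G n = {y. infinite {k. y \<in> K n k}}"
    using gdelta_in_eq_limsup_clopen[OF scY dim G(1)] by metis
  obtain U :: "nat \<Rightarrow> 'a set" where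
    U: "\<And>n. openin X (U n)" "\<And>n. U n \<noteq> {}" "\<And>n. U n \<subseteq> S" "disjoint_family U"
    using infinitely_many_disjoint_opens_in_sequence[OF inf] by metis
  obtain D :: "nat \<Rightarrow> 'a set" where
    D: "\<And>k. finite (D k)" "disjoint_family D" "\<And>k x. x \<in> D k \<Longrightarrow> nowhere_dense_in X {x}"
    "\<And>V. openin X V \<Longrightarrow> V \<noteq> {} \<Longrightarrow> V \<subseteq> S \<Longrightarrow> finite {k. D k \<inter> V = {}}"
    using finite_blocks[OF sc nomin] by metis
  define f where "f y = (\<Union>n. \<Union>k\<in>{k. y \<in> K n k}. D (2 * k) \<inter> U n)" for y
  have mon: "monitorable X (f y) \<longleftrightarrow> (\<forall>n. finite {k. y \<in> K n k})" for y
    using U D f_def by (rule monitorable_blocks_iff)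
  have "continuous_map Y (powerset_topology (topspace X)) f"
  proof (rule continuous_map_into_powerset)
    show "f y \<subseteq> topspace X" for y
      unfolding f_def using openin_subset[OF U(1)] by blast
    \<comment> \<open>A point \<open>x\<close> lies in at most one set
      \<open>D (2 * k) \<inter> U n\<close>, so its membership in \<open>f y\<close> is governed by
      the single clopen set \<open>K n k\<close>, or never occurs.\<close>
    have clopen: "openin Y {y \<in> topspace Y. x \<in> f y} \<and> closedin Y {y \<in> topspace Y. x \<in> f y}" for x
    proof (cases "\<exists>n k. x \<in> D (2 * k) \<inter> U n")
      case False
      then have "{y \<in> topspace Y. x \<in> f y} = {}"
        unfolding f_def by blast
      then show ?thesis
        by (metis openin_empty closedin_empty)
    next
      case True
      then obtain n k where nk: "x \<in> D (2 * k)" "x \<in> U n"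
        by blast
      have "m = n" if "x \<in> U m" for m
        using U(4) that nk(2) unfolding disjoint_family_on_def by blast
      moreover have "l = k" if "x \<in> D (2 * l)" for l
      proof -
        have "2 * l = 2 * k"
          using D(2) that nk(1) unfolding disjoint_family_on_def by blast
        then show ?thesis
          by simp
      qed
      ultimately have "x \<in> f y \<longleftrightarrow> y \<in> K n k" for y
        unfolding f_def using nk by blast
      then have "{y \<in> topspace Y. x \<in> f y} = K n k"
        using openin_subset K(1) by blast
      then show ?thesis
        using K(1) by simp
    qed
    then show "openin Y {y \<in> topspace Y. x \<in> f y}" "closedin Y {y \<in> topspace Y. x \<in> f y}" for x
      by auto
  qed
  moreover have "B = {y \<in> topspace Y. f y \<in> monitorable_sets X}"
    unfolding monitorable_sets_def mem_Collect_eq mon B'(2) G(2) K(2) by auto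
  ultimately show "\<exists>f. continuous_map Y (powerset_topology (topspace X)) f \<and>
      B = {y \<in> topspace Y. f y \<in> monitorable_sets X}"
    by blast
qed

theorem mainTheorem6:
  fixes X :: "'a topology" and H L :: "'a set"
  assumes "countable (topspace X)" and "infinite (topspace X)"
    and "second_countable X"
    and "H = \<Union>{U. minimal_open X U}"
    and "L = X interior_of (topspace X - H)"
  shows "(infinitely_many_disjoint_opens_in X (topspace X - H) \<longleftrightarrow>
            infinitely_many_disjoint_opens_in X L) \<and>
         (infinitely_many_disjoint_opens_in X (topspace X - H) \<longrightarrow>
            Pi0_complete TYPE('y) 3 (powerset_topology (topspace X)) (monitorable_sets X)) \<and>
         (\<not> infinitely_many_disjoint_opens_in X (topspace X - H) \<longrightarrow>
            monitorable_sets X \<in> Sigma0 2 (powerset_topology (topspace X)))"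
proof (intro conjI impI)
  have "openin X U \<and> U \<subseteq> topspace X - H \<longleftrightarrow> openin X U \<and> U \<subseteq> L" for U
    unfolding assms(5) by (metis interior_of_maximal interior_of_subset order_trans)
  then show "infinitely_many_disjoint_opens_in X (topspace X - H) \<longleftrightarrow>
      infinitely_many_disjoint_opens_in X L"
    unfolding infinitely_many_disjoint_opens_in_def by simp
next
  assume inf: "infinitely_many_disjoint_opens_in X (topspace X - H)"
  \<comment> \<open>A minimal open set is non-empty and contained in \<open>H\<close>.\<close>
  have "\<not> W \<subseteq> topspace X - H" if "minimal_open X W" for W
    using that unfolding assms(4) minimal_open_def by blast
  then show "Pi0_complete TYPE('y) 3 (powerset_topology (topspace X)) (monitorable_sets X)"
    unfolding Pi0_complete_def
    using monitorable_sets_in_Pi0_3[OF assms(3)] monitorable_sets_Pi0_3_hard[OF assms(3) inf]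
    by blast
next
  assume "\<not> infinitely_many_disjoint_opens_in X (topspace X - H)"
  then show "monitorable_sets X \<in> Sigma0 2 (powerset_topology (topspace X))"
    unfolding assms(4) by (rule monitorable_sets_in_Sigma0_2[OF assms(3)])
qed

end
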